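(* Let $\mu>0$ be given, and suppose that each $f_i$ ($i\in[n]$) is twice continuously differentiable with $m_i I\preceq\nabla^2 f_i(w)\preceq \ell_i I$ for all $w\in\mathbb{R}^d$, where $0<m_i\le\ell_i<\infty$. Put $m=\min_{i\in[n]} m_i$, $\ell=\max_{i\in[n]}\ell_i$. Suppose the stepsizes $a_i,b_i>0$ ($i\in[n]$) satisfy $$a_i\le \frac{1}{22\mu/9+2\ell},\qquad b_i\le \min\Big\{\frac{\mu}{9},\frac{\underline{\alpha}m^2}{21}\Big\}\qquad\text{for } i\in J_1,$$ $$a_i\le \frac{m_i+\mu}{22\mu/9+2\ell},\qquad b_i\le \frac{1}{\ell_i+\mu}\min\Big\{\frac{\mu}{9},\frac{\underline{\alpha}m^2}{21}\Big\}\qquad\text{for } i\in J_2,$$ where $\underline{\alpha}=\min\{\min_{i\in J_1}a_i,\ \min_{i\in J_2}a_i/(\ell_i+\mu)\}$. Then for all $k=0,1,\dots,K-1$ the iterates of FedHybrid satisfy $$\Delta^{k+1}\le(1-\rho)\Delta^k,$$ where $\Delta^k=13\Delta_\lambda^k+\Delta_{\tilde x}^k$, $$\rho=\min\Big\{\frac{3\underline{\beta}}{13(\mu+\ell)},\ \frac{m\underline{\alpha}}{2}\Big\},\qquad \underline{\beta}=\min\Big\{\min_{i\in J_1}b_i,\ \min_{i\in J_2}b_i(m_i+\mu)\Big\}.$$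
   Context: Fix integers $n,d,K\ge1$, $[n]=\{1,\dots,n\}$, and functions $f_i:\mathbb{R}^d\to\mathbb{R}$, $i\in[n]$. Write $x=(x_1^\top,\dots,x_n^\top)^\top\in\mathbb{R}^{nd}$, $\tilde x=(x_0^\top,x^\top)^\top\in\mathbb{R}^{(n+1)d}$, $\lambda=(\lambda_1^\top,\dots,\lambda_n^\top)^\top\in\mathbb{R}^{nd}$ with all blocks in $\mathbb{R}^d$, and $\tilde f(\tilde x)=f(x)=\sum_{i=1}^n f_i(x_i)$. Let $W=(\mathbf{1}_n,-I_n)\otimes I_d\in\mathbb{R}^{nd\times(n+1)d}$, so the $i$-th block of $W\tilde x$ is $x_0-x_i$. The augmented Lagrangian is $\tilde L(\tilde x,\lambda)=\tilde f(\tilde x)+\lambda^\top W\tilde x+\frac{\mu}{2}\tilde x^\top W^\top W\tilde x$. The dual function is $g(\lambda)=\min_{\tilde x}\tilde L(\tilde x,\lambda)$, $\tilde x^*(\lambda)=\arg\min_{\tilde x}\tilde L(\tilde x,\lambda)$, and $\lambda^*$ is a maximizer of $g$ over $\mathbb{R}^{nd}$. FedHybrid: $[n]$ is the disjoint union of $J_1$ (gradient-type clients) and $J_2$ (Newton-type clients), either possibly empty; a min or max over an empty set is simply omitted. Given initial $x_i^0,\lambda_i^0\in\mathbb{R}^d$, $i\in[n]$, and $x_0^0=\frac1n\sum_i x_i^0-\frac{1}{\mu n}\sum_i\lambda_i^0$, let, for $k=0,1,\dots,K-1$ and $i\in[n]$, $$x_i^{k+1}=x_i^k-a_i(D_i^k)^{-1}\big(\nabla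 f_i(x_i^k)-\lambda_i^k+\mu(x_i^k-x_0^k)\big),\qquad \lambda_i^{k+1}=\lambda_i^k+b_iD_i^k(x_0^k-x_i^k),$$ $$x_0^{k+1}=\frac1n\sum_{i\in[n]}x_i^{k+1}-\frac{1}{\mu n}\sum_{i\in[n]}\lambda_i^{k+1},$$ where $D_i^k=I_d$ for $i\in J_1$ and $D_i^k=\nabla^2 f_i(x_i^k)+\mu I_d$ for $i\in J_2$. The primal tracking error and dual optimality gap are $\Delta_{\tilde x}^k=\tilde L(\tilde x^k,\lambda^k)-\tilde L(\tilde x^*(\lambda^k),\lambda^k)$ and $\Delta_\lambda^k=g(\lambda^* )-g(\lambda^k)$. *)

theory Defs
  imports "HOL-Analysis.Analysis"
begin

definition grad :: "(real^'d \<Rightarrow> real) \<Rightarrow> real^'d \<Rightarrow> real^'d" where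
  "grad f x = (THE v. GDERIV f x :> v)"

definition hess :: "(real^'d \<Rightarrow> real) \<Rightarrow> real^'d \<Rightarrow> real^'d^'d" where
  "hess f x = jacobian (grad f) (at x)"

definition twice_continuously_differentiable :: "(real^'d \<Rightarrow> real) \<Rightarrow> bool" where
  "twice_continuously_differentiable f \<longleftrightarrow>
     f differentiable_on UNIV \<and> grad f differentiable_on UNIV \<and> continuous_on UNIV (hess f)"

definition positive_semidefinite :: "real^'d^'d \<Rightarrow> bool" where
  "positive_semidefinite A \<longleftrightarrow> transpose A = A \<and> (\<forall>v. 0 \<le> v \<bullet> (A *v v))"

definition loewner_le :: "real^'d^'d \<Rightarrow> real^'d^'d \<Rightarrow> bool"  (infix \<open>\<preceq>\<close> 50) where
  "A \<preceq> B \<longleftrightarrow> positive_semidefinite (B - A)"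

text \<open>
  The clients are the elements of the finite type 'n.  A vector of n blocks in R^d has type
  \<^typ>\<open>real^'d^'n\<close>, and the extended vector (x0, x) of n + 1 blocks is a pair.  The operator
  below is the matrix (1, -I) (x) I_d of size nd by (n+1)d, given by its blocks.
\<close>

definition W :: "(real^'d) \<times> (real^'d^'n) \<Rightarrow> real^'d^'n" where
  "W xt = (\<chi> i. fst xt - snd xt $ i)"

definition aug_lagrangian ::
    "('n \<Rightarrow> real^'d \<Rightarrow> real) \<Rightarrow> real \<Rightarrow> (real^'d) \<times> (real^'d^'n) \<Rightarrow> real^'d^'n \<Rightarrow> real" where
  "aug_lagrangian f \<mu> xt lam =
     (\<Sum>i\<in>UNIV. f i (snd xt $ i)) + lam \<bullet> W xt + \<mu> / 2 * (W xt \<bullet> W xt)"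

text \<open>
  The minimum over all extended vectors is the least element of the set of values; it is only
  meaningful when the minimum is attained.  The same applies to the minimizer.
\<close>

definition dual_fun :: "('n \<Rightarrow> real^'d \<Rightarrow> real) \<Rightarrow> real \<Rightarrow> real^'d^'n \<Rightarrow> real" where
  "dual_fun f \<mu> lam = (LEAST v. v \<in> range (\<lambda>xt. aug_lagrangian f \<mu> xt lam))"

definition primal_opt ::
    "('n \<Rightarrow> real^'d \<Rightarrow> real) \<Rightarrow> real \<Rightarrow> real^'d^'n \<Rightarrow> (real^'d) \<times> (real^'d^'n)" where
  "primal_opt f \<mu> lam = (ARG_MIN (\<lambda>xt. aug_lagrangian f \<mu> xt lam) xt. True)"

definition primal_error ::
    "('n \<Rightarrow> real^'d \<Rightarrow> real) \<Rightarrow> real \<Rightarrow> (real^'d) \<times> (real^'d^'n) \<Rightarrow> real^'d^'n \<Rightarrow> real" where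
  "primal_error f \<mu> xt lam =
     aug_lagrangian f \<mu> xt lam - aug_lagrangian f \<mu> (primal_opt f \<mu> lam) lam"

definition dual_gap ::
    "('n \<Rightarrow> real^'d \<Rightarrow> real) \<Rightarrow> real \<Rightarrow> real^'d^'n \<Rightarrow> real^'d^'n \<Rightarrow> real" where
  "dual_gap f \<mu> lam_opt lam = dual_fun f \<mu> lam_opt - dual_fun f \<mu> lam"

text \<open>\<^term>\<open>mat \<mu>\<close> is \<mu> times the identity matrix.\<close>

definition scaling ::
    "('n \<Rightarrow> real^'d \<Rightarrow> real) \<Rightarrow> real \<Rightarrow> 'n set \<Rightarrow> 'n \<Rightarrow> real^'d \<Rightarrow> real^'d^'d" where
  "scaling f \<mu> J1 i w = (if i \<in> J1 then mat 1 else hess (f i) w + mat \<mu>)"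

definition server_update :: "real \<Rightarrow> real^'d^'n \<Rightarrow> real^'d^'n \<Rightarrow> real^'d" where
  "server_update \<mu> x lam =
     (1 / real CARD('n)) *\<^sub>R (\<Sum>i\<in>UNIV. x $ i) - (1 / (\<mu> * real CARD('n))) *\<^sub>R (\<Sum>i\<in>UNIV. lam $ i)"

text \<open>
  The sequences \<^term>\<open>x0\<close>, \<^term>\<open>x\<close>, \<^term>\<open>lam\<close> are a run of K steps of the algorithm from the
  arbitrary initial values \<^term>\<open>x 0\<close> and \<^term>\<open>lam 0\<close>; their entries beyond index K are unconstrained.
\<close>

definition fedhybrid ::
    "('n \<Rightarrow> real^'d \<Rightarrow> real) \<Rightarrow> real \<Rightarrow> 'n set \<Rightarrow> ('n \<Rightarrow> real) \<Rightarrow> ('n \<Rightarrow> real) \<Rightarrow> nat \<Rightarrow>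
     (nat \<Rightarrow> real^'d) \<Rightarrow> (nat \<Rightarrow> real^'d^'n) \<Rightarrow> (nat \<Rightarrow> real^'d^'n) \<Rightarrow> bool" where
  "fedhybrid f \<mu> J1 a b K x0 x lam \<longleftrightarrow>
     x0 0 = server_update \<mu> (x 0) (lam 0) \<and>
     (\<forall>k<K.
        (\<forall>i. x (Suc k) $ i =
               x k $ i - a i *\<^sub>R (matrix_inv (scaling f \<mu> J1 i (x k $ i)) *v
                 (grad (f i) (x k $ i) - lam k $ i + \<mu> *\<^sub>R (x k $ i - x0 k)))) \<and>
        (\<forall>i. lam (Suc k) $ i =
               lam k $ i + b i *\<^sub>R (scaling f \<mu> J1 i (x k $ i) *v (x0 k - x k $ i))) \<and>
        x0 (Suc k) = server_update \<mu> (x (Suc k)) (lam (Suc k)))"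

end

theory Submission
  imports Defs
begin

text \<open>
  Write \<open>u = W y\<close> for the current point \<open>y\<close>, \<open>u*\<close> for its value at the primal minimizer, \<open>r\<close> for the
  gradient in the client blocks, and the two updates as \<open>x - A r\<close> and \<open>lam + B u\<close> with symmetric
  positive definite block diagonal \<open>A\<close> and \<open>B\<close>.  The augmented Lagrangian lies between two
  quadratic models around every point, and the server update makes its gradient in \<open>x0\<close> vanish.
  Hence the primal error is at most \<open>|r|^2 / (2 m)\<close> and \<open>|u - u*| \<le> |r| / m\<close>; testing
  the dual function with the consensus point \<open>(x0*, x0*, ..., x0*)\<close> bounds the dual gap by
  \<open>(\<mu> + l) |u*|^2 / 2\<close>.  The dual function increases by at least
  \<open>u* . B u - |B u|^2 / (2 \<mu>)\<close>, while the Lagrangian changes by at most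
  \<open>- r . A r + (l + \<mu>) |A r|^2 / 2 + u . B u + B u . A r\<close>.  Polarizing \<open>u* . B u\<close> and adding the
  two with the weights 14 and 1 leaves negative multiples of \<open>u* . B u*\<close> and \<open>r . A r\<close>, which
  dominate \<open>\<rho>\<close> times the two gaps.
\<close>

section \<open>Gradients and second-order Taylor expansion\<close>

text \<open>The adjoint of the derivative, applied to 1, represents it as an inner product;
  uniqueness of derivatives then makes the definite description in \<open>grad\<close>
  meaningful.\<close>

lemma GDERIV_grad:
  fixes f :: "real^'d \<Rightarrow> real"
  assumes "f differentiable (at x)"
  shows "GDERIV f x :> grad f x"
proof -
  obtain f' where f': "(f has_derivative f') (at x)"
    using assms unfolding differentiable_def by blast
  have "f' = (\<lambda>h. h \<bullet> adjoint f' 1)"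
    using adjoint_works[OF has_derivative_linear[OF f'], of _ 1] by (auto simp: inner_commute)
  then have "GDERIV f x :> adjoint f' 1"
    using f' unfolding gderiv_def by metis
  moreover have "v = w" if "GDERIV f x :> v" "GDERIV f x :> w" for v w
  proof -
    have "(\<lambda>h. h \<bullet> v) = (\<lambda>h. h \<bullet> w)"
      using that unfolding gderiv_def by (rule has_derivative_unique)
    then have "\<forall>h. h \<bullet> v = h \<bullet> w" by metis
    then show "v = w" by (simp only: vector_eq_ldot)
  qed
  ultimately show ?thesis unfolding grad_def by (metis theI)
qed

text \<open>Restricting \<open>f\<close> to the line through \<open>x\<close> and \<open>y\<close>
  reduces this to the one-dimensional Maclaurin formula of order two with Lagrange
  remainder.\<close>

lemma twice_continuously_differentiable_taylor:
  fixes f :: "real^'d \<Rightarrow> real"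
  assumes "twice_continuously_differentiable f"
  obtains w where "f y = f x + grad f x \<bullet> (y - x) + (y - x) \<bullet> (hess f w *v (y - x)) / 2"
proof -
  define v where "v = y - x"
  define p where "p t = x + t *\<^sub>R v" for t
  have p: "(p has_derivative (\<lambda>s. s *\<^sub>R v)) (at t)" for t
    unfolding p_def by (auto intro!: derivative_eq_intros)
  have d1: "((\<lambda>t. f (p t)) has_real_derivative grad f (p t) \<bullet> v) (at t)" for t
  proof -
    have "GDERIV f (p t) :> grad f (p t)"
      using assms unfolding twice_continuously_differentiable_def differentiable_on_def
      by (auto intro: GDERIV_grad)
    then have "((\<lambda>t. f (p t)) has_derivative (\<lambda>s. (s *\<^sub>R v) \<bullet> grad f (p t))) (at t)"
      unfolding gderiv_def by (rule has_derivative_compose[OF p])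
    then show ?thesis
      by (simp add: has_field_derivative_def inner_commute[of v] mult.commute[of _ "_ \<bullet> _"])
  qed
  have d2: "((\<lambda>t. grad f (p t) \<bullet> v) has_real_derivative v \<bullet> (hess f (p t) *v v)) (at t)" for t
  proof -
    have "(grad f has_derivative (\<lambda>h. hess f (p t) *v h)) (at (p t))"
      using assms
      unfolding twice_continuously_differentiable_def differentiable_on_def hess_def
      by (auto simp: jacobian_works[symmetric])
    then have "((\<lambda>t. grad f (p t)) has_derivative (\<lambda>s. hess f (p t) *v (s *\<^sub>R v))) (at t)"
      by (rule has_derivative_compose[OF p])
    then have "((\<lambda>t. grad f (p t) \<bullet> v) has_derivative (\<lambda>s. (hess f (p t) *v (s *\<^sub>R v)) \<bullet> v)) (at t)"
      by (rule has_derivative_inner_left)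
    then show ?thesis
      by (simp add: has_field_derivative_def inner_commute[of v] mult.commute[of _ "_ \<bullet> _"]
        matrix_vector_mult_scaleR)
  qed
  define diff :: "nat \<Rightarrow> real \<Rightarrow> real" where
    "diff k t = (if k = 0 then f (p t) else if k = 1 then grad f (p t) \<bullet> v
      else v \<bullet> (hess f (p t) *v v))" for k t
  have "\<exists>t>0. t < 1 \<and> f (p 1) = (\<Sum>k<2. diff k 0 / fact k * 1 ^ k) + diff 2 t / fact 2 * 1 ^ 2"
  proof (rule Maclaurin[where f = "\<lambda>t. f (p t)"])
    show "\<forall>k t. k < 2 \<and> 0 \<le> t \<and> t \<le> 1 \<longrightarrow> DERIV (diff k) t :> diff (Suc k) t"
    proof (intro allI impI)
      fix k :: nat and t :: real
      assume "k < 2 \<and> 0 \<le> t \<and> t \<le> 1"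
      then have "k = 0 \<or> k = 1" by auto
      then show "DERIV (diff k) t :> diff (Suc k) t"
        using d1 d2 by (auto simp: diff_def[abs_def])
    qed
  qed (auto simp: diff_def)
  then obtain t where "f (p 1) = diff 0 0 + diff 1 0 + diff 2 t / 2"
    by (auto simp: numeral_2_eq_2)
  then have "f y = f x + grad f x \<bullet> (y - x) + (y - x) \<bullet> (hess f (p t) *v (y - x)) / 2"
    by (simp add: diff_def p_def v_def)
  then show ?thesis by (rule that)
qed

section \<open>Quadratic forms and the Loewner order\<close>

lemma mat_mult_vec: "mat c *v (v::real^'d) = c *\<^sub>R v"
proof -
  have "(mat c :: real^'d^'d) = c *\<^sub>R mat 1"
    by (simp add: mat_def vec_eq_iff)
  then show ?thesis by (simp add: scaleR_matrix_vector_assoc[symmetric])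
qed

lemma loewner_le_quadratic:
  fixes A B :: "real^'d^'d"
  assumes "A \<preceq> B"
  shows "v \<bullet> (A *v v) \<le> v \<bullet> (B *v v)"
  using assms unfolding loewner_le_def positive_semidefinite_def
  by (simp add: matrix_vector_mult_diff_rdistrib inner_diff_right)

lemma transpose_diff: "transpose (A - B) = transpose A - transpose (B :: real^'a^'b)"
  by (simp add: transpose_def vec_eq_iff)

lemma transpose_add: "transpose (A + B) = transpose A + transpose (B :: real^'a^'b)"
  by (simp add: transpose_def vec_eq_iff)

text \<open>The Loewner order makes the difference symmetric, and \<open>mat c\<close> is symmetric.
  This supplies the symmetry of the Hessians.\<close>

lemma symmetric_if_mat_loewner_le:
  fixes A :: "real^'d^'d"
  assumes "mat c \<preceq> A"
  shows "transpose A = A"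
  using assms unfolding loewner_le_def positive_semidefinite_def
  by (simp add: transpose_diff transpose_mat)

text \<open>The step \<open>v - A v / c\<close> has a nonnegative value under the quadratic form of \<open>A\<close>.\<close>

lemma norm_matrix_vector_mult_le:
  fixes A :: "real^'d^'d"
  assumes sym: "transpose A = A"
    and nonneg: "\<And>v. 0 \<le> v \<bullet> (A *v v)"
    and le: "\<And>v. v \<bullet> (A *v v) \<le> c * (v \<bullet> v)"
    and "c > 0"
  shows "(A *v v) \<bullet> (A *v v) \<le> c * (v \<bullet> (A *v v))"
proof -
  define z where "z = A *v v"
  have vz: "v \<bullet> (A *v z) = z \<bullet> z"
    by (metis dot_lmul_matrix sym transpose_matrix_vector z_def)
  have "0 \<le> (v - (1 / c) *\<^sub>R z) \<bullet> (A *v (v - (1 / c) *\<^sub>R z))"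
    by (rule nonneg)
  also have "\<dots> = v \<bullet> z - 2 / c * (z \<bullet> z) + (1 / c)\<^sup>2 * (z \<bullet> (A *v z))"
    using vz
    by (simp add: z_def[symmetric] matrix_vector_mult_diff_distrib matrix_vector_mult_scaleR
      inner_diff_left inner_diff_right power2_eq_square diff_divide_distrib)
  also have "\<dots> \<le> v \<bullet> z - 2 / c * (z \<bullet> z) + (1 / c)\<^sup>2 * (c * (z \<bullet> z))"
    using le[of z] by (intro add_left_mono mult_left_mono) auto
  also have "\<dots> = v \<bullet> z - (z \<bullet> z) / c"
    using \<open>c > 0\<close> by (simp add: power2_eq_square field_simps)
  finally show ?thesis
    using \<open>c > 0\<close> unfolding z_def[symmetric] by (simp add: field_simps)
qed


section \<open>Quadratic models of the augmented Lagrangian\<close>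

lemma W_diff: "W (y - z) = W y - W z"
  by (simp add: W_def vec_eq_iff algebra_simps)

lemma W_scaleR: "W (c *\<^sub>R y) = c *\<^sub>R W y"
  by (simp add: W_def vec_eq_iff algebra_simps)

text \<open>The first-order form of the Hessian bounds: strong convexity and smoothness with
  constants common to all clients.\<close>

locale quadratic_bounds =
  fixes f :: "'n::finite \<Rightarrow> real^'d \<Rightarrow> real" and \<mu> m l :: real
  assumes mu_pos: "0 < \<mu>" and m_pos: "0 < m" and m_le_l: "m \<le> l"
    and continuous: "continuous_on UNIV (f i)"
    and lower: "f i v + grad (f i) v \<bullet> (w - v) + m / 2 * ((w - v) \<bullet> (w - v)) \<le> f i w"
    and upper: "f i w \<le> f i v + grad (f i) v \<bullet> (w - v) + l / 2 * ((w - v) \<bullet> (w - v))"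
begin

abbreviation L where "L \<equiv> aug_lagrangian f \<mu>"

text \<open>The derivative of \<open>L\<close> in its primal argument at \<open>y\<close>, in the
  direction \<open>w\<close>.\<close>

definition G :: "(real^'d) \<times> (real^'d^'n) \<Rightarrow> real^'d^'n \<Rightarrow> (real^'d) \<times> (real^'d^'n) \<Rightarrow> real" where
  "G y lam w = (\<Sum>i\<in>UNIV. grad (f i) (snd y $ i) \<bullet> (snd w $ i)) + lam \<bullet> W w + \<mu> * (W y \<bullet> W w)"

lemma G_scaleR: "G y lam (c *\<^sub>R w) = c * G y lam w"
  by (simp add: G_def W_scaleR sum_distrib_left algebra_simps)

text \<open>The multiplier term is linear and the penalty quadratic, so both expand exactly; only
  the first-order remainders of the \<open>f i\<close> are left to be estimated.\<close>

lemma L_expand: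
  "L z lam = L y lam + G y lam (z - y)
    + (\<Sum>i\<in>UNIV. f i (snd z $ i) - f i (snd y $ i) - grad (f i) (snd y $ i) \<bullet> (snd z $ i - snd y $ i))
    + \<mu> / 2 * (W (z - y) \<bullet> W (z - y))"
proof -
  have "W z = W y + W (z - y)" by (simp add: W_diff)
  then show ?thesis
    by (simp add: aug_lagrangian_def G_def sum_subtractf sum.distrib inner_add_left inner_add_right
      inner_commute algebra_simps)
qed

lemma L_lower:
  "L y lam + G y lam (z - y) + m / 2 * ((snd z - snd y) \<bullet> (snd z - snd y))
    + \<mu> / 2 * (W (z - y) \<bullet> W (z - y)) \<le> L z lam"
proof -
  have "m / 2 * ((snd z - snd y) \<bullet> (snd z - snd y))
      = (\<Sum>i\<in>UNIV. m / 2 * ((snd z $ i - snd y $ i) \<bullet> (snd z $ i - snd y $ i)))"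
    by (simp add: inner_vec_def sum_distrib_left)
  also have "\<dots> \<le> (\<Sum>i\<in>UNIV. f i (snd z $ i) - f i (snd y $ i)
      - grad (f i) (snd y $ i) \<bullet> (snd z $ i - snd y $ i))"
  proof (rule sum_mono)
    fix i
    show "m / 2 * ((snd z $ i - snd y $ i) \<bullet> (snd z $ i - snd y $ i))
      \<le> f i (snd z $ i) - f i (snd y $ i) - grad (f i) (snd y $ i) \<bullet> (snd z $ i - snd y $ i)"
      using lower[of i "snd y $ i" "snd z $ i"] by linarith
  qed
  finally show ?thesis using L_expand[of z lam y] by linarith
qed

lemma L_upper:
  "L z lam \<le> L y lam + G y lam (z - y) + l / 2 * ((snd z - snd y) \<bullet> (snd z - snd y))
    + \<mu> / 2 * (W (z - y) \<bullet> W (z - y))"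
proof -
  have "(\<Sum>i\<in>UNIV. f i (snd z $ i) - f i (snd y $ i)
      - grad (f i) (snd y $ i) \<bullet> (snd z $ i - snd y $ i))
      \<le> (\<Sum>i\<in>UNIV. l / 2 * ((snd z $ i - snd y $ i) \<bullet> (snd z $ i - snd y $ i)))"
  proof (rule sum_mono)
    fix i
    show "f i (snd z $ i) - f i (snd y $ i) - grad (f i) (snd y $ i) \<bullet> (snd z $ i - snd y $ i)
      \<le> l / 2 * ((snd z $ i - snd y $ i) \<bullet> (snd z $ i - snd y $ i))"
      using upper[of i "snd z $ i" "snd y $ i"] by linarith
  qed
  also have "\<dots> = l / 2 * ((snd z - snd y) \<bullet> (snd z - snd y))"
    by (simp add: inner_vec_def sum_distrib_left)
  finally show ?thesis using L_expand[of z lam y] by linarith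
qed

section \<open>Coercivity and existence of primal minimizers\<close>

text \<open>The server block is the sum of block \<open>i\<close> of \<open>W z\<close> and client
  block \<open>i\<close>, for any \<open>i\<close>. Hence the two quadratic terms of
  \<open>L_lower\<close> together control the whole vector.\<close>

lemma inner_le_blocks_W:
  fixes z :: "(real^'d) \<times> (real^'d^'n)"
  shows "z \<bullet> z \<le> 3 * (snd z \<bullet> snd z + W z \<bullet> W z)"
proof -
  obtain i :: 'n where True by blast
  define p q where "p = W z $ i" and "q = snd z $ i"
  have "fst z = p + q" by (simp add: p_def q_def W_def)
  then have "fst z \<bullet> fst z = 2 * (p \<bullet> p) + 2 * (q \<bullet> q) - (p - q) \<bullet> (p - q)"
    by (simp add: inner_add_left inner_add_right inner_diff_left inner_diff_right inner_commute)
  then have 1: "fst z \<bullet> fst z \<le> 2 * (p \<bullet> p) + 2 * (q \<bullet> q)" by simp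
  have block: "v $ i \<bullet> v $ i \<le> v \<bullet> v" for v :: "real^'d^'n"
    unfolding inner_vec_def[of v v] by (rule member_le_sum) auto
  have "0 \<le> W z \<bullet> W z" by simp
  moreover have "z \<bullet> z = fst z \<bullet> fst z + snd z \<bullet> snd z" by (simp add: inner_prod_def)
  ultimately show ?thesis
    using 1 block[of "W z"] block[of "snd z"] unfolding p_def q_def by argo
qed

lemma continuous_L: "continuous_on UNIV (\<lambda>z. L z lam)"
proof -
  have "continuous_on UNIV (\<lambda>z::(real^'d) \<times> (real^'d^'n). f i (snd z $ i))" for i
    by (rule continuous_on_compose2[OF continuous]) (auto intro!: continuous_intros)
  then show ?thesis
    unfolding aug_lagrangian_def W_def by (intro continuous_intros) auto
qed

lemma bounded_G_zero: "\<exists>C. \<forall>z. \<bar>G 0 lam z\<bar> \<le> C * norm z"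
proof -
  have "linear (G 0 lam)"
  proof (rule linearI)
    show "G 0 lam (c *\<^sub>R w) = c *\<^sub>R G 0 lam w" for c w by (simp add: G_scaleR)
    show "G 0 lam (v + w) = G 0 lam v + G 0 lam w" for v w
    proof -
      have "W (v + w) = W v + W w" by (simp add: W_def vec_eq_iff algebra_simps)
      then show ?thesis by (simp add: G_def inner_add_right sum.distrib algebra_simps)
    qed
  qed
  then show ?thesis using linear_bounded[of "G 0 lam"] by simp
qed

text \<open>Quadratic growth beats the linear term outside a ball, and on the compact ball the
  continuous function attains its infimum.\<close>

lemma minimizer_exists: "\<exists>z. \<forall>y. L z lam \<le> L y lam"
proof -
  \<comment> \<open>The 6 combines the factor 3 of \<open>inner_le_blocks_W\<close> with the halves
    in \<open>L_lower\<close>.\<close>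
  define c where "c = min m \<mu> / 6"
  have c: "0 < c" "6 * c \<le> m" "6 * c \<le> \<mu>" using m_pos mu_pos by (auto simp: c_def)
  obtain C where C: "\<And>z. \<bar>G 0 lam z\<bar> \<le> C * norm z" using bounded_G_zero by blast
  \<comment> \<open>From this radius on, \<open>c * (z \<bullet> z)\<close> dominates the linear
    bound \<open>C * norm z\<close>.\<close>
  define R where "R = \<bar>C\<bar> / c"
  have R: "0 \<le> R" using c by (simp add: R_def)
  have far: "L 0 lam \<le> L z lam" if "R \<le> norm z" for z
  proof -
    have "C * norm z \<le> c * R * norm z"
      using c by (simp add: R_def mult_right_mono)
    also have "\<dots> \<le> c * norm z * norm z"
      using that c by (intro mult_right_mono mult_left_mono) auto
    also have "\<dots> = c * (z \<bullet> z)" by (simp add: power2_norm_eq_inner[symmetric] power2_eq_square)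
    also have "\<dots> \<le> c * (3 * (snd z \<bullet> snd z + W z \<bullet> W z))"
      using c inner_le_blocks_W[of z] by (intro mult_left_mono) auto
    also have "\<dots> = 3 * c * (snd z \<bullet> snd z) + 3 * c * (W z \<bullet> W z)" by (simp add: algebra_simps)
    also have "\<dots> \<le> m / 2 * (snd z \<bullet> snd z) + \<mu> / 2 * (W z \<bullet> W z)"
      using c by (intro add_mono mult_right_mono) auto
    finally show ?thesis using L_lower[of 0 lam z] C[of z] by simp
  qed
  have "\<exists>z\<in>cball 0 R. \<forall>y\<in>cball 0 R. L z lam \<le> L y lam"
    using R continuous_on_subset[OF continuous_L]
    by (intro continuous_attains_inf) auto
  then obtain z where z: "\<And>y. norm y \<le> R \<Longrightarrow> L z lam \<le> L y lam"
    unfolding mem_cball_0 Ball_def Bex_def by blast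
  have "L z lam \<le> L y lam" for y
    using z[of y] z[of 0] R far[of y] by (cases "norm y \<le> R") auto
  then show ?thesis by blast
qed

section \<open>Optimality conditions and the dual function\<close>

definition opt where "opt lam = primal_opt f \<mu> lam"

lemma opt_le: "L (opt lam) lam \<le> L y lam"
proof -
  have "is_arg_min (\<lambda>z. L z lam) (\<lambda>_. True) (opt lam)"
    unfolding opt_def primal_opt_def arg_min_def
    by (rule someI_ex) (use minimizer_exists[of lam] in \<open>auto simp: is_arg_min_linorder\<close>)
  then show ?thesis unfolding is_arg_min_linorder by blast
qed

lemma dual_fun_eq: "dual_fun f \<mu> lam = L (opt lam) lam"
  unfolding dual_fun_def by (rule Least_equality) (use opt_le in auto)

text \<open>A negative slope would let a short step decrease \<open>L\<close>, by the upper model;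
  applying this to a direction and its negative gives equality.\<close>

lemma G_opt: "G (opt lam) lam w = 0"
proof -
  have ge: "0 \<le> G (opt lam) lam w" for w
  proof (rule ccontr)
    define e Q where "e = - G (opt lam) lam w"
      and "Q = l / 2 * (snd w \<bullet> snd w) + \<mu> / 2 * (W w \<bullet> W w) + 1"
    assume "\<not> 0 \<le> G (opt lam) lam w"
    then have e: "0 < e" by (simp add: e_def)
    have Q: "1 \<le> Q" using m_pos m_le_l mu_pos by (simp add: Q_def)
    \<comment> \<open>With this step the quadratic term is at most half of the linear decrease
      \<open>t * e\<close>.\<close>
    define t where "t = e / (2 * Q)"
    have t: "0 < t" using e Q by (simp add: t_def)
    have "L (opt lam) lam \<le> L (opt lam + t *\<^sub>R w) lam" by (rule opt_le)
    also have "\<dots> \<le> L (opt lam) lam + (- (t * e) + t\<^sup>2 * (Q - 1))"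
      using L_upper[of "opt lam + t *\<^sub>R w" lam "opt lam"]
      by (simp add: W_scaleR G_scaleR e_def Q_def power2_eq_square algebra_simps)
    finally have "t * e \<le> t\<^sup>2 * (Q - 1)" by linarith
    also have "\<dots> \<le> t * (t * Q)" using t by (simp add: power2_eq_square algebra_simps)
    also have "t * Q = e / 2" using Q by (simp add: t_def)
    finally show False using t e by simp
  qed
  from ge[of w] ge[of "(-1) *\<^sub>R w"] show ?thesis by (simp only: G_scaleR)
qed

lemma L_ge_opt:
  "L (opt lam) lam + m / 2 * ((snd z - snd (opt lam)) \<bullet> (snd z - snd (opt lam)))
    + \<mu> / 2 * (W (z - opt lam) \<bullet> W (z - opt lam)) \<le> L z lam"
  using L_lower[of "opt lam" lam z] by (simp add: G_opt)

text \<open>At a consensus point \<open>W\<close> vanishes, so the value of \<open>L\<close> there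
  is the same for both multipliers; the upper model around \<open>opt lam\<close> then bounds
  it.\<close>

lemma dual_gap_le:
  "L (opt lam') lam' - L (opt lam) lam \<le> (\<mu> + l) / 2 * (W (opt lam) \<bullet> W (opt lam))"
proof -
  define y where "y = opt lam"
  define z :: "(real^'d) \<times> (real^'d^'n)" where "z = (fst y, \<chi> i. fst y)"
  have Wz: "W z = 0" and zy: "snd z - snd y = W y"
    by (simp_all add: z_def W_def vec_eq_iff)
  have "L (opt lam') lam' \<le> L z lam'" by (rule opt_le)
  also have "\<dots> = L z lam" by (simp add: aug_lagrangian_def Wz)
  also have "\<dots> \<le> L y lam + l / 2 * (W y \<bullet> W y) + \<mu> / 2 * (W y \<bullet> W y)"
    using L_upper[of z lam y] by (simp add: y_def[symmetric] G_opt[of lam, folded y_def] zy W_diff Wz)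
  finally show ?thesis by (simp add: y_def[symmetric] algebra_simps add_divide_distrib)
qed

lemma L_change_multiplier: "L z (lam + d) = L z lam + d \<bullet> W z"
  by (simp add: aug_lagrangian_def inner_add_left)

text \<open>The descent lemma for the dual function, with \<open>W (opt lam)\<close> as its
  gradient: the penalty term of \<open>L_ge_opt\<close> completes the square and yields the
  smoothness constant \<open>1 / \<mu>\<close>.\<close>

lemma dual_ascent:
  "L (opt lam) lam + d \<bullet> W (opt lam) - (d \<bullet> d) / (2 * \<mu>) \<le> L (opt (lam + d)) (lam + d)"
proof -
  define v where "v = W (opt (lam + d) - opt lam)"
  have Wopt: "W (opt (lam + d)) = W (opt lam) + v" by (simp add: v_def W_diff)
  have "0 \<le> (d + \<mu> *\<^sub>R v) \<bullet> (d + \<mu> *\<^sub>R v) / (2 * \<mu>)" using mu_pos by simp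
  also have "\<dots> = (d \<bullet> d) / (2 * \<mu>) + d \<bullet> v + \<mu> / 2 * (v \<bullet> v)"
    using mu_pos by (simp add: inner_add_left inner_add_right inner_commute field_simps)
  finally have "- (d \<bullet> d) / (2 * \<mu>) \<le> d \<bullet> v + \<mu> / 2 * (v \<bullet> v)" by simp
  moreover have "L (opt lam) lam + \<mu> / 2 * (v \<bullet> v) \<le> L (opt (lam + d)) lam"
  proof -
    have "0 \<le> m / 2 * ((snd (opt (lam + d)) - snd (opt lam)) \<bullet> (snd (opt (lam + d)) - snd (opt lam)))"
      using m_pos by simp
    then show ?thesis using L_ge_opt[of lam "opt (lam + d)"] by (simp add: v_def)
  qed
  ultimately show ?thesis
    by (simp add: L_change_multiplier Wopt inner_add_right)
qed


section \<open>Stationarity in the server block and error bounds by the residual\<close>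

text \<open>The gradient of \<open>L\<close> in the server block is zero.\<close>

definition balanced :: "(real^'d) \<times> (real^'d^'n) \<Rightarrow> real^'d^'n \<Rightarrow> bool" where
  "balanced y lam \<longleftrightarrow> (\<Sum>i\<in>UNIV. lam $ i + \<mu> *\<^sub>R W y $ i) = 0"

text \<open>The gradient of \<open>L\<close> in the client blocks.\<close>

definition residual :: "(real^'d) \<times> (real^'d^'n) \<Rightarrow> real^'d^'n \<Rightarrow> real^'d^'n" where
  "residual y lam = (\<chi> i. grad (f i) (snd y $ i) - lam $ i - \<mu> *\<^sub>R W y $ i)"

lemma G_residual:
  "G y lam w = residual y lam \<bullet> snd w + fst w \<bullet> (\<Sum>i\<in>UNIV. lam $ i + \<mu> *\<^sub>R W y $ i)"
proof -
  have "G y lam w = (\<Sum>i\<in>UNIV. grad (f i) (snd y $ i) \<bullet> (snd w $ i)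
      + lam $ i \<bullet> (fst w - snd w $ i) + \<mu> * (W y $ i \<bullet> (fst w - snd w $ i)))"
    unfolding G_def inner_vec_def W_def[of w] by (simp add: sum.distrib sum_distrib_left)
  also have "\<dots> = (\<Sum>i\<in>UNIV. (grad (f i) (snd y $ i) - lam $ i - \<mu> *\<^sub>R W y $ i) \<bullet> snd w $ i
      + fst w \<bullet> (lam $ i + \<mu> *\<^sub>R W y $ i))"
    by (rule sum.cong) (auto simp: inner_diff_left inner_diff_right inner_add_right inner_commute
      algebra_simps)
  also have "\<dots> = residual y lam \<bullet> snd w + (\<Sum>i\<in>UNIV. fst w \<bullet> (lam $ i + \<mu> *\<^sub>R W y $ i))"
    by (subst sum.distrib) (simp add: residual_def inner_vec_def[of "vec_lambda _"])
  finally show ?thesis by (simp only: inner_sum_right)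
qed

lemma G_balanced: "balanced y lam \<Longrightarrow> G y lam w = residual y lam \<bullet> snd w"
  by (simp add: G_residual balanced_def)

lemma balanced_opt: "balanced (opt lam) lam"
proof -
  \<comment> \<open>The server gradient itself serves as the test direction in the first-order
    condition.\<close>
  let ?c = "\<Sum>i\<in>UNIV. lam $ i + \<mu> *\<^sub>R W (opt lam) $ i"
  have "?c \<bullet> ?c = 0"
    using G_opt[of lam "(?c, 0)"] unfolding G_residual by simp
  then show ?thesis unfolding balanced_def by (simp only: inner_eq_zero_iff)
qed

text \<open>The lower model around \<open>y\<close>, evaluated at the minimizer; balance removes the
  server block from the linear term.\<close>

lemma residual_inner_ge:
  assumes "balanced y lam"
  shows "L y lam - L (opt lam) lam + m / 2 * ((snd y - snd (opt lam)) \<bullet> (snd y - snd (opt lam)))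
    \<le> residual y lam \<bullet> (snd y - snd (opt lam))"
proof -
  have "0 \<le> \<mu> / 2 * (W (opt lam - y) \<bullet> W (opt lam - y))" using mu_pos by simp
  then have 1: "L y lam + G y lam (opt lam - y)
      + m / 2 * ((snd (opt lam) - snd y) \<bullet> (snd (opt lam) - snd y)) \<le> L (opt lam) lam"
    using L_lower[of y lam "opt lam"] by linarith
  define d where "d = snd y - snd (opt lam)"
  have "snd (opt lam) - snd y = - d" "snd (opt lam - y) = - d" by (simp_all add: d_def)
  with 1 show ?thesis
    unfolding d_def[symmetric] by (simp add: G_balanced[OF assms])
qed

text \<open>A Polyak-Lojasiewicz inequality, from strong convexity by completing the square.\<close>

lemma primal_gap_le:
  assumes "balanced y lam"
  shows "L y lam - L (opt lam) lam \<le> (residual y lam \<bullet> residual y lam) / (2 * m)"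
proof -
  define d r where "d = snd y - snd (opt lam)" and "r = residual y lam"
  have "0 \<le> (r - m *\<^sub>R d) \<bullet> (r - m *\<^sub>R d) / (2 * m)" using m_pos by simp
  also have "\<dots> = (r \<bullet> r) / (2 * m) - r \<bullet> d + m / 2 * (d \<bullet> d)"
    using m_pos by (simp add: inner_diff_left inner_diff_right inner_commute field_simps)
  finally show ?thesis using residual_inner_ge[OF assms] by (simp add: d_def r_def)
qed

text \<open>Averaging kills the common block \<open>fst y - fst (opt lam)\<close>: the blocks of \<open>W (y - opt lam)\<close>
  are the deviations of those of \<open>snd y - snd (opt lam)\<close> from their mean.\<close>

lemma W_error_le:
  assumes "balanced y lam"
  shows "m\<^sup>2 * (W (y - opt lam) \<bullet> W (y - opt lam)) \<le> residual y lam \<bullet> residual y lam"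
proof -
  define d r where "d = snd y - snd (opt lam)" and "r = residual y lam"
  define c where "c = fst y - fst (opt lam)"
  define e where "e = W (y - opt lam)"
  \<comment> \<open>Both points are balanced for the same multiplier, so subtracting the two
    equations shows that \<open>e\<close> has mean zero.\<close>
  have "\<mu> *\<^sub>R (\<Sum>i\<in>UNIV. e $ i) = (\<Sum>i\<in>UNIV. (lam $ i + \<mu> *\<^sub>R W y $ i) - (lam $ i + \<mu> *\<^sub>R W (opt lam) $ i))"
    unfolding scaleR_sum_right by (rule sum.cong) (auto simp: e_def W_diff scaleR_diff_right)
  also have "\<dots> = 0"
    using assms balanced_opt[of lam] unfolding balanced_def sum_subtractf by simp
  finally have sum_e: "(\<Sum>i\<in>UNIV. e $ i) = 0" using mu_pos by simp
  have "d \<bullet> d = (\<Sum>i\<in>UNIV. c \<bullet> c - 2 * (c \<bullet> e $ i) + e $ i \<bullet> e $ i)"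
    unfolding inner_vec_def[of d]
  proof (rule sum.cong)
    fix i
    have "d $ i = c - e $ i" by (simp add: d_def c_def e_def W_def)
    then show "d $ i \<bullet> d $ i = c \<bullet> c - 2 * (c \<bullet> e $ i) + e $ i \<bullet> e $ i"
      by (simp add: inner_diff_left inner_diff_right inner_commute)
  qed simp
  also have "\<dots> = real CARD('n) * (c \<bullet> c) - 2 * (c \<bullet> (\<Sum>i\<in>UNIV. e $ i)) + e \<bullet> e"
    by (simp add: sum.distrib sum_subtractf inner_sum_right sum_distrib_left inner_vec_def[of e])
  finally have "e \<bullet> e \<le> d \<bullet> d" using sum_e by simp
  \<comment> \<open>Half of the constant comes from \<open>residual_inner_ge\<close>, the other half
    from the growth of \<open>L\<close> at its minimizer.\<close>
  moreover have "m * (d \<bullet> d) \<le> r \<bullet> d"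
  proof -
    have "0 \<le> \<mu> / 2 * (W (y - opt lam) \<bullet> W (y - opt lam))" using mu_pos by simp
    then show ?thesis
      using residual_inner_ge[OF assms] L_ge_opt[of lam y] unfolding d_def r_def by linarith
  qed
  moreover have "0 \<le> (r - m *\<^sub>R d) \<bullet> (r - m *\<^sub>R d)" by simp
  then have "2 * m * (r \<bullet> d) \<le> r \<bullet> r + m\<^sup>2 * (d \<bullet> d)"
    by (simp add: inner_diff_left inner_diff_right inner_commute power2_eq_square algebra_simps)
  moreover have "2 * m * (m * (d \<bullet> d)) \<le> 2 * m * (r \<bullet> d)"
    using m_pos \<open>m * (d \<bullet> d) \<le> r \<bullet> d\<close> by (intro mult_left_mono) auto
  moreover have "m\<^sup>2 * (e \<bullet> e) \<le> m\<^sup>2 * (d \<bullet> d)"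
    using \<open>e \<bullet> e \<le> d \<bullet> d\<close> by (intro mult_left_mono) auto
  ultimately show ?thesis unfolding e_def r_def power2_eq_square by (simp add: mult.assoc)
qed

section \<open>The one-step contraction\<close>

text \<open>\<open>B\<close> and \<open>s\<close> stand for the dual scaling and the primal step;
  only their spectral bounds enter. The new dual value occurs 13 times in the dual gap and once in
  the primal error, hence the weight 14.\<close>

lemma contraction_step:
  assumes bal: "balanced y lam" and bal': "balanced y' lam'"
    and B: "linear B" "\<And>v w. B v \<bullet> w = v \<bullet> B w"
    and B_lower: "\<And>v. \<beta> * (v \<bullet> v) \<le> v \<bullet> B v"
    and B_upper: "\<And>v. v \<bullet> B v \<le> c * (v \<bullet> v)"
    and B_norm: "\<And>v. B v \<bullet> B v \<le> c * (v \<bullet> B v)"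
    and c: "c \<le> \<mu> / 9" "c \<le> \<alpha> * m\<^sup>2 / 21"
    and s_lower: "\<alpha> * (residual y lam \<bullet> residual y lam) \<le> residual y lam \<bullet> s"
    and s_norm: "(22 * \<mu> / 9 + 2 * l) * (s \<bullet> s) \<le> residual y lam \<bullet> s"
    and nonneg: "0 \<le> \<alpha>" "0 \<le> \<beta>"
    and snd_y': "snd y' = snd y - s" and lam': "lam' = lam + B (W y)"
    and \<rho>: "\<rho> \<le> 3 * \<beta> / (13 * (\<mu> + l))" "\<rho> \<le> m * \<alpha> / 2"
    and max: "L (opt lam) lam \<le> L (opt lam_opt) lam_opt"
  shows "13 * (L (opt lam_opt) lam_opt - L (opt lam') lam') + (L y' lam' - L (opt lam') lam')
    \<le> (1 - \<rho>) * (13 * (L (opt lam_opt) lam_opt - L (opt lam) lam) + (L y lam - L (opt lam) lam))"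
proof -
  define u us e r where "u = W y" and "us = W (opt lam)" and "e = W (y - opt lam)"
    and "r = residual y lam"
  note s_lower = s_lower[folded r_def] and s_norm = s_norm[folded r_def]
    and lam' = lam'[folded u_def]
  have l_pos: "0 < l" using m_pos m_le_l by simp
  have B_nonneg: "0 \<le> v \<bullet> B v" for v
    using B_lower[of v] nonneg(2) by (meson inner_ge_zero mult_nonneg_nonneg order_trans)
  have e: "us = u - e" by (simp add: u_def us_def e_def W_diff)
  have polar: "B u \<bullet> us = (us \<bullet> B us + u \<bullet> B u - e \<bullet> B e) / 2"
  proof -
    have "B us = B u - B e" unfolding e by (rule linear_diff[OF B(1)])
    moreover have "e \<bullet> B u = u \<bullet> B e" using B(2)[of u e] by (simp add: inner_commute)
    ultimately show ?thesis
      using B(2)[of u u] B(2)[of u e] unfolding e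
      by (simp add: inner_diff_left inner_diff_right)
  qed
  have Bu: "B u \<bullet> B u \<le> \<mu> / 9 * (u \<bullet> B u)"
    using B_norm[of u] mult_right_mono[OF c(1) B_nonneg[of u]] by linarith
  have dual: "L (opt lam) lam + (us \<bullet> B us + u \<bullet> B u - e \<bullet> B e) / 2 - (u \<bullet> B u) / 18
      \<le> L (opt lam') lam'"
  proof -
    have "(B u \<bullet> B u) / (2 * \<mu>) \<le> (u \<bullet> B u) / 18"
      using Bu mu_pos by (simp add: field_simps)
    then show ?thesis
      using dual_ascent[of lam "B u"] unfolding lam' us_def[symmetric] polar by linarith
  qed
  have primal: "L y' lam' \<le> L y lam - r \<bullet> s + (l + \<mu>) / 2 * (s \<bullet> s) + u \<bullet> B u + B u \<bullet> s"
  proof -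
    \<comment> \<open>The intermediate point moves the clients but keeps the old server block. As
      \<open>y'\<close> has the same clients and is balanced, passing from \<open>z\<close> to
      \<open>y'\<close> cannot increase \<open>L\<close>.\<close>
    define z where "z = (fst y, snd y - s)"
    have Wzy: "W (z - y) = s" by (simp add: z_def W_def vec_eq_iff)
    then have Wz: "W z = u + s" by (simp add: W_diff u_def algebra_simps)
    have zy': "snd z - snd y' = 0" by (simp add: z_def snd_y')
    have "0 \<le> \<mu> / 2 * (W (z - y') \<bullet> W (z - y'))" using mu_pos by simp
    then have "L y' lam' \<le> L z lam'"
      using L_lower[of y' lam' z] by (simp add: G_balanced[OF bal'] zy')
    also have "\<dots> = L z lam + u \<bullet> B u + B u \<bullet> s"
      by (simp add: lam' L_change_multiplier Wz inner_add_right inner_commute)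
    also have "L z lam \<le> L y lam - r \<bullet> s + (l + \<mu>) / 2 * (s \<bullet> s)"
      using L_upper[of z lam y] Wzy
      by (simp add: G_balanced[OF bal, folded r_def] z_def algebra_simps add_divide_distrib)
    finally show ?thesis by simp
  qed
  have cross: "B u \<bullet> s \<le> 47 / 9 * (u \<bullet> B u) + \<mu> / 188 * (s \<bullet> s)"
  proof -
    define p where "p = B u"
    \<comment> \<open>The weight is tuned so that \<open>u \<bullet> B u\<close> receives 47/9 = 7 -
      7/9 - 1, exactly what 14 times \<open>dual\<close> leaves after the term in
      \<open>primal\<close>.\<close>
    have "0 \<le> (p - (\<mu> / 94) *\<^sub>R s) \<bullet> (p - (\<mu> / 94) *\<^sub>R s) * (47 / \<mu>)" using mu_pos by simp
    also have "\<dots> = 47 / \<mu> * (p \<bullet> p) - p \<bullet> s + \<mu> / 188 * (s \<bullet> s)"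
      using mu_pos by (simp add: inner_diff_left inner_diff_right inner_commute field_simps)
    finally have "p \<bullet> s \<le> 47 / \<mu> * (p \<bullet> p) + \<mu> / 188 * (s \<bullet> s)" by simp
    moreover have "47 / \<mu> * (p \<bullet> p) \<le> 47 / \<mu> * (\<mu> / 9 * (u \<bullet> B u))"
      using Bu mu_pos unfolding p_def by (intro mult_left_mono) auto
    ultimately show ?thesis using mu_pos unfolding p_def by simp
  qed
  have s_small: "(l + \<mu>) / 2 * (s \<bullet> s) + \<mu> / 188 * (s \<bullet> s) \<le> (r \<bullet> s) / 4"
  proof -
    have "0 \<le> \<mu> * (s \<bullet> s)" "0 \<le> l * (s \<bullet> s)" using mu_pos l_pos by auto
    then show ?thesis using s_norm unfolding ring_distribs add_divide_distrib by linarith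
  qed
  \<comment> \<open>The factor 7 is 14/2 from the polarization; the 21 in the bound on
    \<open>c\<close> turns it into 1/3.\<close>
  have error: "7 * (e \<bullet> B e) \<le> (r \<bullet> s) / 3"
  proof -
    have "e \<bullet> B e \<le> \<alpha> * m\<^sup>2 / 21 * (e \<bullet> e)"
      using B_upper[of e] mult_right_mono[OF c(2), of "e \<bullet> e"] by simp
    also have "\<dots> = \<alpha> / 21 * (m\<^sup>2 * (e \<bullet> e))" by simp
    also have "\<dots> \<le> \<alpha> / 21 * (r \<bullet> r)"
      using W_error_le[OF bal, folded e_def r_def] nonneg(1) by (intro mult_left_mono) auto
    finally show ?thesis using s_lower by simp
  qed
  have gap_dual: "13 * (\<rho> * (L (opt lam_opt) lam_opt - L (opt lam) lam)) \<le> 3 / 2 * (us \<bullet> B us)"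
  proof -
    have "\<rho> * (L (opt lam_opt) lam_opt - L (opt lam) lam)
        \<le> 3 * \<beta> / (13 * (\<mu> + l)) * (L (opt lam_opt) lam_opt - L (opt lam) lam)"
      using \<rho>(1) max by (intro mult_right_mono) auto
    also have "\<dots> \<le> 3 * \<beta> / (13 * (\<mu> + l)) * ((\<mu> + l) / 2 * (us \<bullet> us))"
      using dual_gap_le[of lam_opt lam, folded us_def] nonneg(2) mu_pos l_pos by (intro mult_left_mono) auto
    also have "\<dots> = 3 / 26 * (\<beta> * (us \<bullet> us))"
      using mu_pos l_pos by (simp add: divide_simps)
    also have "\<dots> \<le> 3 / 26 * (us \<bullet> B us)" using B_lower[of us] by simp
    finally show ?thesis by simp
  qed
  have gap_primal: "\<rho> * (L y lam - L (opt lam) lam) \<le> (r \<bullet> s) / 4"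
  proof -
    have "\<rho> * (L y lam - L (opt lam) lam) \<le> m * \<alpha> / 2 * (L y lam - L (opt lam) lam)"
      using \<rho>(2) opt_le[of lam y] by (intro mult_right_mono) auto
    also have "\<dots> \<le> m * \<alpha> / 2 * ((r \<bullet> r) / (2 * m))"
      using primal_gap_le[OF bal, folded r_def] nonneg(1) m_pos by (intro mult_left_mono) auto
    also have "\<dots> = \<alpha> * (r \<bullet> r) / 4" using m_pos by simp
    finally show ?thesis using s_lower by simp
  qed
  have "0 \<le> r \<bullet> s"
    using s_lower nonneg(1) by (simp add: order_trans[OF _ s_lower])
  moreover have "(1 - \<rho>) * (13 * (L (opt lam_opt) lam_opt - L (opt lam) lam) + (L y lam - L (opt lam) lam))
      = 13 * (L (opt lam_opt) lam_opt - L (opt lam) lam) + (L y lam - L (opt lam) lam)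
        - 13 * (\<rho> * (L (opt lam_opt) lam_opt - L (opt lam) lam)) - \<rho> * (L y lam - L (opt lam) lam)"
    by algebra
  \<comment> \<open>The terms in \<open>u \<bullet> B u\<close> cancel. What remains is -7 times
    \<open>us \<bullet> B us\<close>, covering 3/2, and -1 + 1/4 + 1/3 = -5/12 times
    \<open>r \<bullet> s\<close>, covering 1/4.\<close>
  ultimately show ?thesis
    using dual primal cross s_small error gap_dual gap_primal B_nonneg[of us] by argo
qed

end

section \<open>Block diagonal scalings and their spectral bounds\<close>

text \<open>Positive definiteness makes the kernel trivial, so \<open>A\<close> is invertible and
  the choice in \<open>matrix_inv\<close> yields an inverse.\<close>

lemma matrix_vector_mult_matrix_inv:
  fixes A :: "real^'d^'d"
  assumes "0 < p" and "\<And>v. p * (v \<bullet> v) \<le> v \<bullet> (A *v v)"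
  shows "A *v (matrix_inv A *v v) = v"
proof -
  have "v = 0" if "A *v v = 0" for v
  proof -
    have "p * (v \<bullet> v) \<le> 0" using assms(2)[of v] that by simp
    then have "v \<bullet> v \<le> 0" using assms(1) by (simp add: mult_le_0_iff)
    then show "v = 0" using inner_gt_zero_iff[of v] by linarith
  qed
  then have "\<exists>B. B ** A = mat 1" unfolding matrix_left_invertible_ker by blast
  then have "invertible A" by (simp add: invertible_left_inverse)
  then have "A ** matrix_inv A = mat 1"
    unfolding invertible_def matrix_inv_def by (rule someI2_ex) blast
  then show ?thesis by (simp add: matrix_vector_mul_assoc)
qed

text \<open>Treats both client types at once: the bounds are 1 for gradient-type clients and the
  shifted Hessian bounds for Newton-type ones.\<close>

locale spectral_bounds =
  fixes D :: "'n::finite \<Rightarrow> real^'d^'d" and p q :: "'n \<Rightarrow> real"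
  assumes p_pos: "0 < p i" and p_le_q: "p i \<le> q i"
    and sym: "transpose (D i) = D i"
    and D_lower: "p i * (v \<bullet> v) \<le> v \<bullet> (D i *v v)"
    and D_upper: "v \<bullet> (D i *v v) \<le> q i * (v \<bullet> v)"
begin

lemma q_pos: "0 < q i"
  using p_pos[of i] p_le_q[of i] by simp

lemma D_nonneg: "0 \<le> v \<bullet> (D i *v v)"
  using D_lower[of i v] p_pos[of i] by (meson inner_ge_zero less_imp_le mult_nonneg_nonneg order_trans)

lemma D_norm: "(D i *v v) \<bullet> (D i *v v) \<le> q i * (v \<bullet> (D i *v v))"
  by (rule norm_matrix_vector_mult_le[OF sym D_nonneg D_upper q_pos])

lemma D_inv: "D i *v (matrix_inv (D i) *v v) = v"
  by (rule matrix_vector_mult_matrix_inv[OF p_pos D_lower])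

definition primal_step :: "('n \<Rightarrow> real) \<Rightarrow> real^'d^'n \<Rightarrow> real^'d^'n" where
  "primal_step a r = (\<chi> i. a i *\<^sub>R (matrix_inv (D i) *v (r $ i)))"

definition dual_step :: "('n \<Rightarrow> real) \<Rightarrow> real^'d^'n \<Rightarrow> real^'d^'n" where
  "dual_step b u = (\<chi> i. b i *\<^sub>R (D i *v (u $ i)))"

text \<open>With \<open>r $ i\<close> written as \<open>D i *v w\<close>, the bound
  \<open>D_norm\<close> says that the inverse of \<open>D i\<close> is at least
  \<open>1 / q i\<close>.\<close>

lemma primal_step_lower:
  assumes "\<And>i. 0 < a i" and "\<And>i. \<alpha> \<le> a i / q i"
  shows "\<alpha> * (r \<bullet> r) \<le> r \<bullet> primal_step a r"
  unfolding inner_vec_def[of r] unfolding primal_step_def sum_distrib_left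
proof (rule sum_mono)
  fix i
  define w where "w = matrix_inv (D i) *v (r $ i)"
  have w: "D i *v w = r $ i" by (simp add: w_def D_inv)
  have "\<alpha> * (r $ i \<bullet> r $ i) \<le> a i / q i * (r $ i \<bullet> r $ i)"
    using assms(2) by (intro mult_right_mono) auto
  also have "\<dots> \<le> a i / q i * (q i * (w \<bullet> r $ i))"
    using D_norm[of i w] assms(1)[of i] q_pos[of i] unfolding w by (intro mult_left_mono) auto
  also have "\<dots> = a i * (w \<bullet> r $ i)" using q_pos[of i] by simp
  finally show "\<alpha> * (r $ i \<bullet> r $ i) \<le> r $ i \<bullet> (\<chi> i. a i *\<^sub>R (matrix_inv (D i) *v (r $ i))) $ i"
    by (simp add: w_def inner_commute)
qed

text \<open>The same substitution leaves \<open>a i * (w \<bullet> w)\<close> to compare with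
  \<open>w \<bullet> (D i *v w)\<close>, which \<open>D_lower\<close> does.\<close>

lemma primal_step_norm:
  assumes "\<And>i. 0 < a i" and "\<And>i. h * a i \<le> p i"
  shows "h * (primal_step a r \<bullet> primal_step a r) \<le> r \<bullet> primal_step a r"
  unfolding inner_vec_def[of r] inner_vec_def[of "primal_step a r"]
  unfolding primal_step_def sum_distrib_left
proof (rule sum_mono)
  fix i
  define w where "w = matrix_inv (D i) *v (r $ i)"
  have w: "D i *v w = r $ i" by (simp add: w_def D_inv)
  have "h * (a i * (a i * (w \<bullet> w))) = a i * (h * a i * (w \<bullet> w))" by simp
  also have "\<dots> \<le> a i * (p i * (w \<bullet> w))"
    using assms(1)[of i] assms(2)[of i] by (intro mult_left_mono mult_right_mono) auto
  also have "\<dots> \<le> a i * (w \<bullet> r $ i)"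
    using D_lower[of i w] assms(1)[of i] unfolding w by (intro mult_left_mono) auto
  finally show "h * ((\<chi> i. a i *\<^sub>R (matrix_inv (D i) *v (r $ i))) $ i \<bullet>
        (\<chi> i. a i *\<^sub>R (matrix_inv (D i) *v (r $ i))) $ i)
      \<le> r $ i \<bullet> (\<chi> i. a i *\<^sub>R (matrix_inv (D i) *v (r $ i))) $ i"
    by (simp add: w_def inner_commute)
qed

lemma linear_dual_step: "linear (dual_step b)"
  by (rule linearI)
    (simp_all add: dual_step_def vec_eq_iff matrix_vector_right_distrib matrix_vector_mult_scaleR
      algebra_simps)

lemma dual_step_inner: "dual_step b v \<bullet> w = v \<bullet> dual_step b w"
proof -
  have "(D i *v y) \<bullet> z = y \<bullet> (D i *v z)" for i y z
    by (metis dot_lmul_matrix sym transpose_matrix_vector)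
  then show ?thesis
    unfolding inner_vec_def[of v] inner_vec_def[of "dual_step b v"] by (simp add: dual_step_def)
qed

lemma dual_step_lower:
  assumes "\<And>i. 0 < b i" and "\<And>i. \<beta> \<le> b i * p i"
  shows "\<beta> * (v \<bullet> v) \<le> v \<bullet> dual_step b v"
  unfolding inner_vec_def[of v] unfolding dual_step_def sum_distrib_left
proof (rule sum_mono)
  fix i
  have "\<beta> * (v $ i \<bullet> v $ i) \<le> b i * p i * (v $ i \<bullet> v $ i)"
    using assms(2) by (intro mult_right_mono) auto
  also have "\<dots> \<le> b i * (v $ i \<bullet> (D i *v (v $ i)))"
    using D_lower[of i "v $ i"] assms(1)[of i] by (simp add: mult.assoc)
  finally show "\<beta> * (v $ i \<bullet> v $ i) \<le> v $ i \<bullet> (\<chi> i. b i *\<^sub>R (D i *v (v $ i))) $ i"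
    by simp
qed

lemma dual_step_upper:
  assumes "\<And>i. 0 < b i" and "\<And>i. b i * q i \<le> c"
  shows "v \<bullet> dual_step b v \<le> c * (v \<bullet> v)"
  unfolding inner_vec_def[of v] unfolding dual_step_def sum_distrib_left
proof (rule sum_mono)
  fix i
  have "b i * (v $ i \<bullet> (D i *v (v $ i))) \<le> b i * q i * (v $ i \<bullet> v $ i)"
    using D_upper[of "v $ i" i] assms(1)[of i] by (simp add: mult.assoc)
  also have "\<dots> \<le> c * (v $ i \<bullet> v $ i)"
    using assms(2) by (intro mult_right_mono) auto
  finally show "v $ i \<bullet> (\<chi> i. b i *\<^sub>R (D i *v (v $ i))) $ i \<le> c * (v $ i \<bullet> v $ i)"
    by simp
qed

lemma dual_step_norm:
  assumes "\<And>i. 0 < b i" and "\<And>i. b i * q i \<le> c"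
  shows "dual_step b v \<bullet> dual_step b v \<le> c * (v \<bullet> dual_step b v)"
  unfolding inner_vec_def[of v] inner_vec_def[of "dual_step b v"]
  unfolding dual_step_def sum_distrib_left
proof (rule sum_mono)
  fix i
  define z where "z = D i *v (v $ i)"
  have "b i * (b i * (z \<bullet> z)) \<le> b i * (b i * (q i * (v $ i \<bullet> z)))"
    using D_norm[of i "v $ i"] assms(1)[of i] unfolding z_def by (intro mult_left_mono) auto
  also have "\<dots> = b i * q i * (b i * (v $ i \<bullet> z))" by simp
  also have "\<dots> \<le> c * (b i * (v $ i \<bullet> z))"
    using D_nonneg[of "v $ i" i] assms(1)[of i] assms(2)[of i] unfolding z_def
    by (intro mult_right_mono) auto
  finally show "(\<chi> i. b i *\<^sub>R (D i *v (v $ i))) $ i \<bullet> (\<chi> i. b i *\<^sub>R (D i *v (v $ i))) $ i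
      \<le> c * (v $ i \<bullet> (\<chi> i. b i *\<^sub>R (D i *v (v $ i))) $ i)"
    by (simp add: z_def)
qed

end

section \<open>Application to the FedHybrid iterates\<close>

text \<open>The server update is the balance equation solved for the server block.\<close>

lemma server_update_balanced:
  fixes y lam :: "real^'d^'n"
  assumes "\<mu> > 0"
  shows "(\<Sum>i\<in>UNIV. lam $ i + \<mu> *\<^sub>R W (server_update \<mu> y lam, y) $ i) = 0"
proof -
  define N where "N = real CARD('n)"
  have N: "N > 0" by (simp add: N_def)
  have "\<mu> *\<^sub>R N *\<^sub>R server_update \<mu> y lam = \<mu> *\<^sub>R (\<Sum>i\<in>UNIV. y $ i) - (\<Sum>i\<in>UNIV. lam $ i)"
    using N assms by (simp add: server_update_def N_def[symmetric] scaleR_diff_right)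
  moreover have "(\<Sum>i\<in>UNIV. lam $ i + \<mu> *\<^sub>R W (server_update \<mu> y lam, y) $ i)
      = (\<Sum>i\<in>UNIV. lam $ i) + \<mu> *\<^sub>R N *\<^sub>R server_update \<mu> y lam - \<mu> *\<^sub>R (\<Sum>i\<in>UNIV. y $ i)"
    by (simp add: W_def N_def sum.distrib sum_subtractf scaleR_diff_right scaleR_sum_right
      sum_constant_scaleR del: sum_constant)
  ultimately show ?thesis by simp
qed

lemma hess_quadratic_bounds:
  assumes "mat c \<preceq> hess f w \<and> hess f w \<preceq> mat d"
  shows "c * (v \<bullet> v) \<le> v \<bullet> (hess f w *v v)" and "v \<bullet> (hess f w *v v) \<le> d * (v \<bullet> v)"
  using assms loewner_le_quadratic[of "mat c" "hess f w" v] loewner_le_quadratic[of "hess f w" "mat d" v]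
  by (simp_all add: mat_mult_vec)

theorem theorem4p1:
  fixes f :: "'n::finite \<Rightarrow> real^'d \<Rightarrow> real"
    and \<mu> m \<l> \<alpha> \<beta> \<rho> :: real
    and ms ls a b :: "'n \<Rightarrow> real"
    and J1 J2 :: "'n set"
    and K :: nat
    and x0 :: "nat \<Rightarrow> real^'d"
    and x lam :: "nat \<Rightarrow> real^'d^'n"
    and lam_opt :: "real^'d^'n"
    and \<Delta> :: "nat \<Rightarrow> real"
  assumes K: "K \<ge> 1"
    and mu: "\<mu> > 0"
    and C2: "\<And>i. twice_continuously_differentiable (f i)"
    and hess_bounds: "\<And>i w. mat (ms i) \<preceq> hess (f i) w \<and> hess (f i) w \<preceq> mat (ls i)"
    and ms_ls: "\<And>i. 0 < ms i \<and> ms i \<le> ls i"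
    and m: "m = Min (range ms)"
    and l: "\<l> = Max (range ls)"
    and clients: "J1 \<union> J2 = UNIV" "J1 \<inter> J2 = {}"
    and alpha: "\<alpha> = Min (a ` J1 \<union> (\<lambda>i. a i / (ls i + \<mu>)) ` J2)"
    and beta: "\<beta> = Min (b ` J1 \<union> (\<lambda>i. b i * (ms i + \<mu>)) ` J2)"
    and steps_pos: "\<And>i. a i > 0 \<and> b i > 0"
    and a_J1: "\<And>i. i \<in> J1 \<Longrightarrow> a i \<le> 1 / (22 * \<mu> / 9 + 2 * \<l>)"
    and b_J1: "\<And>i. i \<in> J1 \<Longrightarrow> b i \<le> min (\<mu> / 9) (\<alpha> * m^2 / 21)"
    and a_J2: "\<And>i. i \<in> J2 \<Longrightarrow> a i \<le> (ms i + \<mu>) / (22 * \<mu> / 9 + 2 * \<l>)"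
    and b_J2: "\<And>i. i \<in> J2 \<Longrightarrow> b i \<le> 1 / (ls i + \<mu>) * min (\<mu> / 9) (\<alpha> * m^2 / 21)"
    and lam_opt: "is_arg_max (dual_fun f \<mu>) (\<lambda>_. True) lam_opt"
    and run: "fedhybrid f \<mu> J1 a b K x0 x lam"
    and Delta: "\<And>k. \<Delta> k = 13 * dual_gap f \<mu> lam_opt (lam k) + primal_error f \<mu> (x0 k, x k) (lam k)"
    and rho: "\<rho> = min (3 * \<beta> / (13 * (\<mu> + \<l>))) (m * \<alpha> / 2)"
  shows "\<forall>k<K. \<Delta> (Suc k) \<le> (1 - \<rho>) * \<Delta> k"
proof (intro allI impI)
  fix k
  assume "k < K"
  have m_le: "m \<le> ms i" for i unfolding m by simp
  have le_l: "ls i \<le> \<l>" for i unfolding l by simp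
  have "m \<in> range ms" unfolding m by (rule Min_in) auto
  then have m_pos: "0 < m" using ms_ls by auto
  have l_pos: "0 < \<l>" using ms_ls le_l by (meson less_le_trans)
  interpret quadratic_bounds f \<mu> m \<l>
  proof
    show "0 < \<mu>" "0 < m" by fact+
    show "m \<le> \<l>" using m_le le_l ms_ls by (meson order_trans)
    fix i v w
    have "f i differentiable_on UNIV"
      using C2 by (simp add: twice_continuously_differentiable_def)
    then show "continuous_on UNIV (f i)" by (rule differentiable_imp_continuous_on)
    obtain z where z: "f i w = f i v + grad (f i) v \<bullet> (w - v)
        + (w - v) \<bullet> (hess (f i) z *v (w - v)) / 2"
      by (rule twice_continuously_differentiable_taylor[OF C2])
    note H = hess_quadratic_bounds[OF hess_bounds[of i z], of "w - v"]
    have "m * ((w - v) \<bullet> (w - v)) \<le> ms i * ((w - v) \<bullet> (w - v))"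
      using m_le by (intro mult_right_mono) auto
    with z H(1) show "f i v + grad (f i) v \<bullet> (w - v) + m / 2 * ((w - v) \<bullet> (w - v)) \<le> f i w"
      by simp
    have "ls i * ((w - v) \<bullet> (w - v)) \<le> \<l> * ((w - v) \<bullet> (w - v))"
      using le_l by (intro mult_right_mono) auto
    with z H(2) show "f i w \<le> f i v + grad (f i) v \<bullet> (w - v) + \<l> / 2 * ((w - v) \<bullet> (w - v))"
      by simp
  qed
  define D where "D i = scaling f \<mu> J1 i (x k $ i)" for i
  define p q where "p i = (if i \<in> J1 then 1 else ms i + \<mu>)"
    and "q i = (if i \<in> J1 then 1 else ls i + \<mu>)" for i
  interpret spectral_bounds D p q
  proof
    fix i and v :: "real^'d"
    note H = hess_quadratic_bounds[OF hess_bounds[of i "x k $ i"], of v]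
    show "0 < p i" "p i \<le> q i"
      using ms_ls[of i] mu by (auto simp: p_def q_def)
    show "transpose (D i) = D i"
      using symmetric_if_mat_loewner_le[OF conjunct1[OF hess_bounds]]
      by (simp add: D_def scaling_def transpose_add transpose_mat)
    show "p i * (v \<bullet> v) \<le> v \<bullet> (D i *v v)" "v \<bullet> (D i *v v) \<le> q i * (v \<bullet> v)"
      using H by (simp_all add: D_def scaling_def p_def q_def matrix_vector_mult_add_rdistrib
        mat_mult_vec inner_add_right distrib_right)
  qed
  define h where "h = 22 * \<mu> / 9 + 2 * \<l>"
  define c where "c = min (\<mu> / 9) (\<alpha> * m\<^sup>2 / 21)"
  have h: "0 < h" using mu l_pos by (simp add: h_def)
  have J2: "i \<in> J2" if "i \<notin> J1" for i using clients(1) that by blast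
  have ms_mu: "0 < ms i + \<mu>" and ls_mu: "0 < ls i + \<mu>" for i
    using ms_ls[of i] mu by linarith+
  \<comment> \<open>Either client set may be empty, but not both, so \<alpha> and \<beta> are
    attained minima.\<close>
  have nonempty: "J1 \<union> J2 \<noteq> {}" using clients(1) by simp
  have "\<alpha> \<in> a ` J1 \<union> (\<lambda>i. a i / (ls i + \<mu>)) ` J2"
    unfolding alpha by (rule Min_in) (use nonempty in auto)
  then have \<alpha>: "0 \<le> \<alpha>"
    using ls_mu steps_pos by (auto simp: less_imp_le)
  have "\<beta> \<in> b ` J1 \<union> (\<lambda>i. b i * (ms i + \<mu>)) ` J2"
    unfolding beta by (rule Min_in) (use nonempty in auto)
  then have \<beta>: "0 \<le> \<beta>"
    using ms_mu steps_pos by (auto simp: less_imp_le)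
  have a_pos: "0 < a i" and b_pos: "0 < b i" for i using steps_pos by auto
  have a_lower: "\<alpha> \<le> a i / q i" for i
    using J2[of i] unfolding alpha by (intro Min_le) (auto simp: q_def)
  \<comment> \<open>In terms of \<open>p\<close>, the two stepsize rules for \<open>a\<close> become
    one; likewise for \<open>b\<close> and \<open>q\<close> below.\<close>
  have a_upper: "h * a i \<le> p i" for i
    using a_J1[of i] a_J2[OF J2, of i] h unfolding p_def h_def[symmetric]
    by (auto simp: field_simps)
  have b_lower: "\<beta> \<le> b i * p i" for i
    using J2[of i] unfolding beta by (intro Min_le) (auto simp: p_def)
  have b_upper: "b i * q i \<le> c" for i
    using b_J1[of i] b_J2[OF J2, of i] ms_ls[of i] mu unfolding q_def c_def[symmetric]
    by (auto simp: field_simps)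
  \<comment> \<open>Index 0 is covered by the initialization, each later index up to
    \<open>K\<close> by the preceding step.\<close>
  have server: "x0 j = server_update \<mu> (x j) (lam j)" if "j \<le> K" for j
    using run that unfolding fedhybrid_def by (cases j) auto
  have bal: "balanced (x0 j, x j) (lam j)" if "j \<le> K" for j
    unfolding balanced_def server[OF that] by (rule server_update_balanced[OF mu])
  let ?y = "(x0 k, x k)"
  let ?r = "residual ?y (lam k)"
  \<comment> \<open>Since \<open>W\<close> has blocks server minus client, the bracket in the client
    update is the residual.\<close>
  have x_Suc: "x (Suc k) = x k - primal_step a ?r"
    using run \<open>k < K\<close>
    by (simp add: fedhybrid_def vec_eq_iff primal_step_def residual_def W_def D_def
      scaleR_diff_right algebra_simps)
  have lam_Suc: "lam (Suc k) = lam k + dual_step b (W ?y)"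
    using run \<open>k < K\<close> by (simp add: fedhybrid_def vec_eq_iff dual_step_def W_def D_def)
  have max: "L (opt lam') lam' \<le> L (opt lam_opt) lam_opt" for lam'
    using lam_opt unfolding is_arg_max_linorder dual_fun_eq by blast
  have Delta': "\<Delta> j = 13 * (L (opt lam_opt) lam_opt - L (opt (lam j)) (lam j))
      + (L (x0 j, x j) (lam j) - L (opt (lam j)) (lam j))" for j
    by (simp add: Delta dual_gap_def primal_error_def dual_fun_eq opt_def)
  show "\<Delta> (Suc k) \<le> (1 - \<rho>) * \<Delta> k"
    unfolding Delta'
  proof (rule contraction_step)
    show "balanced ?y (lam k)" "balanced (x0 (Suc k), x (Suc k)) (lam (Suc k))"
      using bal \<open>k < K\<close> by simp_all
    show "c \<le> \<mu> / 9" "c \<le> \<alpha> * m\<^sup>2 / 21" by (simp_all add: c_def)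
    show "\<rho> \<le> 3 * \<beta> / (13 * (\<mu> + \<l>))" "\<rho> \<le> m * \<alpha> / 2" by (simp_all add: rho)
    show "(22 * \<mu> / 9 + 2 * \<l>) * (primal_step a ?r \<bullet> primal_step a ?r) \<le> ?r \<bullet> primal_step a ?r"
      using primal_step_norm[OF a_pos a_upper] unfolding h_def .
    show "snd (x0 (Suc k), x (Suc k)) = snd ?y - primal_step a ?r" by (simp add: x_Suc)
  qed (fact linear_dual_step dual_step_inner \<alpha> \<beta> max lam_Suc
      dual_step_lower[OF b_pos b_lower] dual_step_upper[OF b_pos b_upper]
      dual_step_norm[OF b_pos b_upper] primal_step_lower[OF a_pos a_lower])+
qed

end
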